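(* For a finite set $S\subset\mathbb{R}^n$, the following are equivalent. (1) $S$ is exact. (2) $\mathcal{I}(S)$ is $(1,1)$-sos. (3) There is a linear inequality description of $\mathrm{conv}(S)$, of the form $g_i(\mathbf{x})\ge 0$ $(i=1,\ldots,m)$, where each $g_i$ is $1$-sos mod $\mathcal{I}(S)$. (4) There is a linear inequality description of $\mathrm{conv}(S)$, of the form $g_i(\mathbf{x})\ge0$ $(i=1,\ldots,m)$, where each $g_i$ is an idempotent mod $\mathcal{I}(S)$, i.e., $g_i^2-g_i\in\mathcal{I}(S)$ for $i=1,\ldots,m$. (5) There is a linear inequality description of $\mathrm{conv}(S)$, of the form $g_i(\mathbf{x})\ge0$ $(i=1,\ldots,m)$, where each $g_i$ takes at most two different values in $S$, i.e., for each $i$, $S$ is contained in the union of the hyperplane $g_i(\mathbf{x})=0$ and one unique parallel translate of it.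
   Context: $\mathbb{R}[\mathbf{x}]=\mathbb{R}[x_1,\ldots,x_n]$; a polynomial is linear if it has degree at most $1$ (affine linear), and a linear inequality description of $\mathrm{conv}(S)$ is a finite family of linear polynomials $g_i$ with $\mathrm{conv}(S)=\{\mathbf{x}\in\mathbb{R}^n : g_i(\mathbf{x})\ge0,\ i=1,\ldots,m\}$. $\mathcal{I}(S)$ is the ideal of all polynomials in $\mathbb{R}[\mathbf{x}]$ vanishing on $S$. For an ideal $I$, $f$ is $1$-sos mod $I$ if there are polynomials $h_1,\ldots,h_t$ of degree at most $1$ with $f-\sum_j h_j^2\in I$. $I$ is $(1,1)$-sos if every polynomial of degree at most $1$ that is non-negative on the real variety $\mathcal{V}_{\mathbb{R}}(I)$ is $1$-sos mod $I$. $\mathrm{TH}_1(I):=\{\mathbf{x}\in\mathbb{R}^n : f(\mathbf{x})\ge0\text{ for every linear } f \text{ that is } 1\text{-sos mod } I\}$. $S$ is exact if $\mathcal{I}(S)$ is $\mathrm{TH}_1$-exact, i.e., $\mathrm{TH}_1(\mathcal{I}(S))=\mathrm{cl}(\mathrm{conv}(\mathcal{V}_{\mathbb{R}}(\mathcal{I}(S))))$ (which equals $\mathrm{conv}(S)$ as $S$ is finite). *)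

theory Defs
  imports "HOL-Analysis.Analysis" "HOL-Library.Poly_Mapping"
begin

text \<open>
  The polynomial ring over the reals in variables indexed by the finite type \<^typ>\<open>'n\<close>: a monomial is its
  exponent vector, a polynomial is a finitely supported map from monomials to coefficients, and
  multiplication is the convolution product provided by the library.
\<close>

type_synonym 'n mpoly_real = "('n \<Rightarrow>\<^sub>0 nat) \<Rightarrow>\<^sub>0 real"

definition mp_eval :: "'n::finite mpoly_real \<Rightarrow> real ^ 'n \<Rightarrow> real" where
  "mp_eval p x =
     (\<Sum>m\<in>Poly_Mapping.keys p. Poly_Mapping.lookup p m * (\<Prod>i\<in>UNIV. (x $ i) ^ Poly_Mapping.lookup m i))"

text \<open>The zero polynomial gets degree 0, so that it counts as having degree at most 1.\<close>

definition total_degree :: "'n::finite mpoly_real \<Rightarrow> nat" where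
  "total_degree p =
     Max (insert 0 ((\<lambda>m. \<Sum>i\<in>UNIV. Poly_Mapping.lookup m i) ` Poly_Mapping.keys p))"

definition linear_poly :: "'n::finite mpoly_real \<Rightarrow> bool" where
  "linear_poly p \<longleftrightarrow> total_degree p \<le> 1"

definition vanishing_ideal :: "(real ^ 'n::finite) set \<Rightarrow> 'n mpoly_real set" where
  "vanishing_ideal S = {p. \<forall>s\<in>S. mp_eval p s = 0}"

text \<open>
  The following notions are meant for ideals \<open>I\<close>; the formulas make sense for any set of
  polynomials, and the ideal property is not imposed in the definitions.
\<close>

definition real_variety :: "'n::finite mpoly_real set \<Rightarrow> (real ^ 'n) set" where
  "real_variety I = {x. \<forall>p\<in>I. mp_eval p x = 0}"

definition one_sos_mod :: "'n::finite mpoly_real set \<Rightarrow> 'n mpoly_real \<Rightarrow> bool" where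
  "one_sos_mod I f \<longleftrightarrow> (\<exists>hs. (\<forall>h\<in>set hs. linear_poly h) \<and> f - (\<Sum>h\<leftarrow>hs. h ^ 2) \<in> I)"

definition one_one_sos :: "'n::finite mpoly_real set \<Rightarrow> bool" where
  "one_one_sos I \<longleftrightarrow>
     (\<forall>f. linear_poly f \<and> (\<forall>x\<in>real_variety I. 0 \<le> mp_eval f x) \<longrightarrow> one_sos_mod I f)"

definition TH1 :: "'n::finite mpoly_real set \<Rightarrow> (real ^ 'n) set" where
  "TH1 I = {x. \<forall>f. linear_poly f \<and> one_sos_mod I f \<longrightarrow> 0 \<le> mp_eval f x}"

definition TH1_exact :: "'n::finite mpoly_real set \<Rightarrow> bool" where
  "TH1_exact I \<longleftrightarrow> TH1 I = closure (convex hull (real_variety I))"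

definition exact_set :: "(real ^ 'n::finite) set \<Rightarrow> bool" where
  "exact_set S \<longleftrightarrow> TH1_exact (vanishing_ideal S)"

text \<open>The list \<open>gs\<close> is the finite family of polynomials; the empty family describes the whole space.\<close>

definition linear_ineq_description :: "'n::finite mpoly_real list \<Rightarrow> (real ^ 'n) set \<Rightarrow> bool" where
  "linear_ineq_description gs C \<longleftrightarrow>
     (\<forall>g\<in>set gs. linear_poly g) \<and> C = {x. \<forall>g\<in>set gs. 0 \<le> mp_eval g x}"

definition idempotent_mod :: "'n::finite mpoly_real set \<Rightarrow> 'n mpoly_real \<Rightarrow> bool" where
  "idempotent_mod I g \<longleftrightarrow> g ^ 2 - g \<in> I"

definition at_most_two_values :: "(real ^ 'n::finite) set \<Rightarrow> 'n mpoly_real \<Rightarrow> bool" where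
  "at_most_two_values S g \<longleftrightarrow> finite (mp_eval g ` S) \<and> card (mp_eval g ` S) \<le> 2"

text \<open>
  \<open>S\<close> lies in the union of the zero set of \<open>g\<close> and one translate of it.  Unlike
  \<^const>\<open>at_most_two_values\<close>, this normalises one of the two values of \<open>g\<close> to be zero.
\<close>

definition in_two_translates :: "(real ^ 'n::finite) set \<Rightarrow> 'n mpoly_real \<Rightarrow> bool" where
  "in_two_translates S g \<longleftrightarrow>
     (\<exists>v. S \<subseteq> {x. mp_eval g x = 0} \<union> (\<lambda>x. v + x) ` {x. mp_eval g x = 0})"

end

theory Submission
  imports Defs
begin

text \<open>
  The heart of the matter is that exactness forces every facet inequality \<open>g \<ge> 0\<close> to take only two
  values on \<open>S\<close>.  Let \<open>g\<close> vanish on the facet and let \<open>s, q \<in> S\<close> lie off it.  Then \<open>s\<close> is an affine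
  combination, with coefficient \<open>c = g s / g q\<close> at \<open>q\<close>, of \<open>q\<close> and points of \<open>S\<close> on the facet.  Up to an
  arbitrarily small error, each square \<open>h\<^sup>2\<close> with \<open>h\<close> affine satisfies \<open>h\<^sup>2 s \<le> c\<^sup>2 h\<^sup>2 q\<close> plus a
  multiple of the values of \<open>h\<^sup>2\<close> on the facet.  This linear inequality passes to sums of squares and,
  by exactness, to \<open>g\<close>, giving \<open>g s \<le> c\<^sup>2 g q\<close>, that is \<open>g q \<le> g s\<close>; equality follows by symmetry.

  Conversely, a two-valued inequality can be translated and scaled to be idempotent, hence a square
  modulo the ideal, and by the affine Farkas lemma every linear polynomial that is nonnegative on \<open>S\<close> is
  a conic combination of \<open>1\<close> and the polynomials of the description.
\<close>

section \<open>Evaluation of polynomials\<close>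

lemma mp_eval_mono_neutral:
  assumes "finite A" "Poly_Mapping.keys p \<subseteq> A"
  shows "mp_eval p x =
    (\<Sum>m\<in>A. Poly_Mapping.lookup p m * (\<Prod>i\<in>UNIV. (x $ i) ^ Poly_Mapping.lookup m i))"
  unfolding mp_eval_def using assms by (intro sum.mono_neutral_left) (auto simp: in_keys_iff)

lemma mp_eval_add: "mp_eval (p + q) x = mp_eval p x + mp_eval q x"
proof -
  have fin: "finite (Poly_Mapping.keys p \<union> Poly_Mapping.keys q)"
    by simp
  show ?thesis
    using keys_add[of p q]
    by (simp add: mp_eval_mono_neutral[OF fin] lookup_add distrib_right sum.distrib)
qed

lemma mp_eval_0 [simp]: "mp_eval 0 x = 0"
  by (simp add: mp_eval_def)

lemma mp_eval_diff: "mp_eval (p - q) x = mp_eval p x - mp_eval q x"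
  using mp_eval_add[of "p - q" q x] by simp

lemma mp_eval_sum: "mp_eval (\<Sum>i\<in>A. p i) x = (\<Sum>i\<in>A. mp_eval (p i) x)"
  by (induction A rule: infinite_finite_induct) (auto simp: mp_eval_add)

lemma mp_eval_single:
  "mp_eval (Poly_Mapping.single m c) x = c * (\<Prod>i\<in>UNIV. (x $ i) ^ Poly_Mapping.lookup m i)"
  by (simp add: mp_eval_def)

text \<open>Splits a polynomial into single terms, which reduces multiplicativity of evaluation and
  the shape of linear polynomials to monomials.\<close>

lemma poly_mapping_expansion:
  "p = (\<Sum>m\<in>Poly_Mapping.keys p. Poly_Mapping.single m (Poly_Mapping.lookup p m))"
proof (rule poly_mapping_eqI)
  fix k
  have "(\<Sum>m\<in>Poly_Mapping.keys p. (Poly_Mapping.lookup p m when m = k))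
      = Poly_Mapping.lookup p k"
    by (simp add: when_def sum.delta in_keys_iff)
  then show "Poly_Mapping.lookup p k = Poly_Mapping.lookup
      (\<Sum>m\<in>Poly_Mapping.keys p. Poly_Mapping.single m (Poly_Mapping.lookup p m)) k"
    by (simp add: lookup_sum lookup_single)
qed

lemma mp_eval_mult: "mp_eval (p * q) x = mp_eval p x * mp_eval q x"
proof -
  have single: "mp_eval (Poly_Mapping.single k a * Poly_Mapping.single l b) x =
      mp_eval (Poly_Mapping.single k a) x * mp_eval (Poly_Mapping.single l b) x" for k l a b
    by (simp add: mult_single mp_eval_single lookup_add power_add prod.distrib)
  have "mp_eval (p * q) x = mp_eval
      ((\<Sum>m\<in>Poly_Mapping.keys p. Poly_Mapping.single m (Poly_Mapping.lookup p m)) *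
       (\<Sum>m\<in>Poly_Mapping.keys q. Poly_Mapping.single m (Poly_Mapping.lookup q m))) x"
    using poly_mapping_expansion[of p] poly_mapping_expansion[of q] by simp
  also have "\<dots> =
      mp_eval (\<Sum>m\<in>Poly_Mapping.keys p. Poly_Mapping.single m (Poly_Mapping.lookup p m)) x *
      mp_eval (\<Sum>m\<in>Poly_Mapping.keys q. Poly_Mapping.single m (Poly_Mapping.lookup q m)) x"
    by (simp add: sum_product mp_eval_sum single)
  also have "\<dots> = mp_eval p x * mp_eval q x"
    using poly_mapping_expansion[of p] poly_mapping_expansion[of q] by simp
  finally show ?thesis .
qed

lemma mp_eval_1 [simp]: "mp_eval 1 x = 1"
  using mp_eval_single[of 0 1 x] by simp

lemma mp_eval_power: "mp_eval (p ^ k) x = mp_eval p x ^ k"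
  by (induction k) (auto simp: mp_eval_mult)

lemma mp_eval_prod: "mp_eval (\<Prod>i\<in>A. p i) x = (\<Prod>i\<in>A. mp_eval (p i) x)"
  by (induction A rule: infinite_finite_induct) (auto simp: mp_eval_mult)

lemma mp_eval_sum_list: "mp_eval (\<Sum>h\<leftarrow>hs. p h) x = (\<Sum>h\<leftarrow>hs. mp_eval (p h) x)"
  by (induction hs) (auto simp: mp_eval_add)

text \<open>
  A pair \<open>w = (a, b)\<close> encodes the affine function sending \<open>x\<close> to \<open>a \<bullet> x + b\<close>, which is the inner
  product of \<open>w\<close> with the homogenised point \<open>(x, 1)\<close>.
\<close>

definition affine_poly :: "(real ^ 'n) \<times> real \<Rightarrow> 'n::finite mpoly_real" where
  "affine_poly w = Poly_Mapping.single 0 (snd w) +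
     (\<Sum>i\<in>UNIV. Poly_Mapping.single (Poly_Mapping.single i 1) (fst w $ i))"

lemma mp_eval_affine_poly [simp]: "mp_eval (affine_poly w) x = w \<bullet> (x, 1)"
proof -
  have "(\<Prod>j\<in>UNIV. (x $ j) ^ Poly_Mapping.lookup (Poly_Mapping.single i 1) j) = x $ i" for i
  proof -
    have "(x $ j) ^ Poly_Mapping.lookup (Poly_Mapping.single i 1) j = (if j = i then x $ j else 1)"
      for j by (simp add: lookup_single when_def)
    then show ?thesis
      by (simp add: prod.delta)
  qed
  then show ?thesis
    by (cases w) (simp add: affine_poly_def mp_eval_add mp_eval_sum mp_eval_single inner_vec_def)
qed

lemma linear_poly_iff:
  "linear_poly p \<longleftrightarrow>
    (\<forall>m\<in>Poly_Mapping.keys p. (\<Sum>i\<in>UNIV. Poly_Mapping.lookup m i) \<le> 1)"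
  by (auto simp: linear_poly_def total_degree_def)

lemma linear_poly_affine_poly [simp]: "linear_poly (affine_poly w)"
proof -
  have "Poly_Mapping.keys (affine_poly w) \<subseteq> Poly_Mapping.keys (Poly_Mapping.single 0 (snd w)) \<union>
      (\<Union>i. Poly_Mapping.keys (Poly_Mapping.single (Poly_Mapping.single i 1) (fst w $ i)))"
    unfolding affine_poly_def by (rule order.trans[OF keys_add Un_mono[OF order.refl keys_sum]])
  also have "\<dots> \<subseteq> insert 0 (range (\<lambda>i. Poly_Mapping.single i 1))"
    by auto
  finally have "Poly_Mapping.keys (affine_poly w) \<subseteq> insert 0 (range (\<lambda>i. Poly_Mapping.single i 1))" .
  moreover have "(\<Sum>j\<in>UNIV. Poly_Mapping.lookup (Poly_Mapping.single i (1::nat)) j) = 1"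
    for i :: 'a
    by (simp add: lookup_single when_def)
  ultimately show ?thesis
    unfolding linear_poly_iff by fastforce
qed

text \<open>An exponent vector of sum at most 1 is zero or a single unit, so each term evaluates to
  a constant or to a multiple of a coordinate. This lets later arguments replace a linear polynomial
  by the vector \<open>w\<close>.\<close>

lemma linear_polyE:
  fixes p :: "'n::finite mpoly_real"
  assumes "linear_poly p"
  obtains w :: "(real ^ 'n) \<times> real" where "mp_eval p = (\<lambda>x. w \<bullet> (x, 1))"
proof -
  have "\<exists>w :: (real ^ 'n) \<times> real. \<forall>x. mp_eval (Poly_Mapping.single m c) x = w \<bullet> (x, 1)"
    if m: "(\<Sum>i\<in>UNIV. Poly_Mapping.lookup m i) \<le> 1" for m :: "'n \<Rightarrow>\<^sub>0 nat" and c
  proof (cases "m = 0")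
    case True
    then show ?thesis
      by (intro exI[of _ "(0, c)"]) (simp add: mp_eval_single)
  next
    case False
    then obtain i where i: "Poly_Mapping.lookup m i \<noteq> 0"
      by (metis lookup_zero poly_mapping_eqI)
    have s: "(\<Sum>j\<in>UNIV. Poly_Mapping.lookup m j) =
        Poly_Mapping.lookup m i + (\<Sum>j\<in>UNIV - {i}. Poly_Mapping.lookup m j)"
      by (rule sum.remove) auto
    have "(\<Sum>j\<in>UNIV - {i}. Poly_Mapping.lookup m j) = 0" and mi: "Poly_Mapping.lookup m i = 1"
      using s m i by linarith+
    then have "Poly_Mapping.lookup m j = 0" if "j \<noteq> i" for j
      using that by simp
    then have "(x $ j) ^ Poly_Mapping.lookup m j = (if j = i then x $ j else 1)"
      for j and x :: "real ^ 'n" using mi by simp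
    then have "mp_eval (Poly_Mapping.single m c) x = c * x $ i" for x
      by (simp add: mp_eval_single prod.delta)
    then show ?thesis
      by (intro exI[of _ "(axis i c, 0)"]) (simp add: inner_axis')
  qed
  then have "\<forall>m. \<exists>w :: (real ^ 'n) \<times> real. m \<in> Poly_Mapping.keys p \<longrightarrow>
      (\<forall>x. mp_eval (Poly_Mapping.single m (Poly_Mapping.lookup p m)) x = w \<bullet> (x, 1))"
    using assms unfolding linear_poly_iff by blast
  then obtain w :: "_ \<Rightarrow> (real ^ 'n) \<times> real"
    where w: "mp_eval (Poly_Mapping.single m (Poly_Mapping.lookup p m)) x = w m \<bullet> (x, 1)"
    if "m \<in> Poly_Mapping.keys p" for m x
    by metis
  have "mp_eval p x = (\<Sum>m\<in>Poly_Mapping.keys p. w m) \<bullet> (x, 1)" for x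
    by (subst poly_mapping_expansion) (simp add: mp_eval_sum w inner_sum_left)
  then show ?thesis by (intro that) auto
qed

section \<open>Sums of squares modulo the vanishing ideal\<close>

lemma real_variety_vanishing_ideal:
  assumes "finite S"
  shows "real_variety (vanishing_ideal S) = S"
proof
  show "S \<subseteq> real_variety (vanishing_ideal S)"
    by (auto simp: real_variety_def vanishing_ideal_def)
  \<comment> \<open>The product of the squared distances to the points of \<open>S\<close>: it
    vanishes exactly on \<open>S\<close>, so this one member of the ideal already cuts the variety
    down to \<open>S\<close>.\<close>
  define p where "p = (\<Prod>s\<in>S. \<Sum>i\<in>UNIV. affine_poly (axis i 1, - (s $ i)) ^ 2)"
  have p: "mp_eval p x = (\<Prod>s\<in>S. \<Sum>i\<in>UNIV. (x $ i - s $ i)\<^sup>2)" for x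
    by (simp add: p_def mp_eval_prod mp_eval_sum mp_eval_power inner_axis')
  have "p \<in> vanishing_ideal S"
    using assms by (force simp: vanishing_ideal_def p intro!: prod_zero)
  moreover have "x \<in> S" if "mp_eval p x = 0" for x
    using that assms by (auto simp: p sum_nonneg_eq_0_iff vec_eq_iff[symmetric])
  ultimately show "real_variety (vanishing_ideal S) \<subseteq> S"
    by (auto simp: real_variety_def)
qed

text \<open>Membership in the vanishing ideal depends only on values on \<open>S\<close>, and linear
  polynomials have the values of vectors \<open>w\<close>. Hence being 1-sos becomes a statement
  about real numbers, without polynomials.\<close>

lemma one_sos_mod_vanishing_ideal_iff:
  fixes S :: "(real ^ 'n::finite) set"
  shows "one_sos_mod (vanishing_ideal S) f \<longleftrightarrow>
    (\<exists>ws :: ((real ^ 'n) \<times> real) list. \<forall>s\<in>S. mp_eval f s = (\<Sum>w\<leftarrow>ws. (w \<bullet> (s, 1))\<^sup>2))"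
proof
  assume "one_sos_mod (vanishing_ideal S) f"
  then obtain hs where lin: "\<forall>h\<in>set hs. linear_poly h"
    and hs: "f - (\<Sum>h\<leftarrow>hs. h ^ 2) \<in> vanishing_ideal S"
    by (auto simp: one_sos_mod_def)
  have "\<forall>h. \<exists>w :: (real ^ 'n) \<times> real. linear_poly h \<longrightarrow> (\<forall>x. mp_eval h x = w \<bullet> (x, 1))"
    by (metis linear_polyE)
  then obtain w :: "_ \<Rightarrow> (real ^ 'n) \<times> real" where w: "mp_eval h x = w h \<bullet> (x, 1)" if "linear_poly h" for h x
    by metis
  have "mp_eval f s = (\<Sum>w\<leftarrow>map w hs. (w \<bullet> (s, 1))\<^sup>2)" if "s \<in> S" for s
  proof -
    have "mp_eval f s = (\<Sum>h\<leftarrow>hs. (mp_eval h s)\<^sup>2)"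
      using hs that
      by (auto simp: vanishing_ideal_def mp_eval_diff mp_eval_sum_list mp_eval_power)
    also have "\<dots> = (\<Sum>w\<leftarrow>map w hs. (w \<bullet> (s, 1))\<^sup>2)"
      using lin w by (auto simp: o_def intro!: arg_cong[where f = sum_list] map_cong)
    finally show ?thesis .
  qed
  then show "\<exists>ws :: ((real ^ 'n) \<times> real) list. \<forall>s\<in>S. mp_eval f s = (\<Sum>w\<leftarrow>ws. (w \<bullet> (s, 1))\<^sup>2)"
    by blast
next
  assume "\<exists>ws :: ((real ^ 'n) \<times> real) list. \<forall>s\<in>S. mp_eval f s = (\<Sum>w\<leftarrow>ws. (w \<bullet> (s, 1))\<^sup>2)"
  then obtain ws :: "((real ^ 'n) \<times> real) list" where "\<forall>s\<in>S. mp_eval f s = (\<Sum>w\<leftarrow>ws. (w \<bullet> (s, 1))\<^sup>2)"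
    by blast
  then show "one_sos_mod (vanishing_ideal S) f"
    unfolding one_sos_mod_def
    by (intro exI[of _ "map affine_poly ws"])
       (auto simp: vanishing_ideal_def mp_eval_diff mp_eval_sum_list mp_eval_power o_def)
qed

lemma exact_set_iff:
  assumes "finite S"
  shows "exact_set S \<longleftrightarrow> TH1 (vanishing_ideal S) = convex hull S"
  using assms
  by (simp add: exact_set_def TH1_exact_def real_variety_vanishing_ideal
      finite_imp_compact_convex_hull compact_imp_closed)

text \<open>Ensures that conic combinations of 1-sos polynomials stay 1-sos: lists of squares are
  concatenated for a sum, and each vector is scaled by \<open>sqrt c\<close> for multiplication by
  \<open>c\<close>.\<close>

lemma convex_cone_one_sos:
  fixes S :: "(real ^ 'n::finite) set"
  shows "convex_cone {w. one_sos_mod (vanishing_ideal S) (affine_poly w)}"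
proof -
  define sos where "sos w ws \<longleftrightarrow> (\<forall>s\<in>S. w \<bullet> (s, 1) = (\<Sum>v\<leftarrow>ws. (v \<bullet> (s, 1))\<^sup>2))"
    for w :: "(real ^ 'n) \<times> real" and ws :: "((real ^ 'n) \<times> real) list"
  have "sos 0 []"
    by (simp add: sos_def)
  moreover have "sos (v + w) (vs @ ws)" if "sos v vs" "sos w ws" for v w vs ws
    using that by (simp add: sos_def inner_add_left)
  moreover have "sos (c *\<^sub>R w) (map (\<lambda>v. sqrt c *\<^sub>R v) ws)" if "sos w ws" "0 \<le> c" for c w ws
    using that by (simp add: sos_def o_def power_mult_distrib sum_list_const_mult)
  moreover have "one_sos_mod (vanishing_ideal S) (affine_poly w) \<longleftrightarrow> (\<exists>ws. sos w ws)" for w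
    by (simp add: one_sos_mod_vanishing_ideal_iff sos_def)
  ultimately show ?thesis
    unfolding convex_cone_iff by (metis mem_Collect_eq)
qed

section \<open>Convex geometry\<close>

text \<open>If \<open>w\<close> lay outside the closed cone, a separating vector
  \<open>a = (y, t)\<close> would be nonnegative on the cone and negative on \<open>w\<close>.
  Moving far from \<open>(x0, 1)\<close> in direction \<open>a\<close> and dividing by the last
  coordinate yields a feasible point where \<open>w\<close> is negative. Starting at the feasible
  \<open>x0\<close> keeps that coordinate positive even if \<open>t = 0\<close>.\<close>

lemma affine_Farkas:
  fixes G :: "('a::euclidean_space \<times> real) set"
  assumes "finite G" and x0: "\<And>g. g \<in> G \<Longrightarrow> 0 \<le> g \<bullet> (x0, 1)"
    and w: "\<And>x. (\<And>g. g \<in> G \<Longrightarrow> 0 \<le> g \<bullet> (x, 1)) \<Longrightarrow> 0 \<le> w \<bullet> (x, 1)"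
  shows "w \<in> convex_cone hull (insert (0, 1) G)"
proof (rule ccontr)
  let ?K = "convex_cone hull (insert (0, 1) G)"
  assume "w \<notin> ?K"
  moreover have "convex ?K"
    by (rule convex_convex_cone_hull)
  moreover have "closed ?K"
    using \<open>finite G\<close> by (intro closed_convex_cone_hull) simp
  ultimately obtain a b where ab: "a \<bullet> w < b" "\<forall>k\<in>?K. a \<bullet> k > b"
    using separating_hyperplane_closed_point by metis
  have "b < 0"
    using ab(2) convex_cone_hull_contains_0 by fastforce
  have nonneg: "0 \<le> a \<bullet> k" if "k \<in> ?K" for k
  proof (rule ccontr)
    assume "\<not> 0 \<le> a \<bullet> k"
    \<comment> \<open>The factor is a quotient of two negative numbers. It scales \<open>k\<close>
      to a point of the cone where the functional equals \<open>b\<close>, against strict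
      separation.\<close>
    then have "(b / (a \<bullet> k)) *\<^sub>R k \<in> ?K"
      using that \<open>b < 0\<close> by (intro convex_cone_hull_mul) (auto simp: divide_nonpos_neg)
    with ab(2) have "b / (a \<bullet> k) * (a \<bullet> k) > b"
      by fastforce
    with \<open>\<not> 0 \<le> a \<bullet> k\<close> show False by simp
  qed
  obtain y t where a: "a = (y, t)" by fastforce
  have "0 \<le> t"
    using nonneg[of "(0, 1)"] by (auto simp: a hull_inc)
  \<comment> \<open>Chosen so that \<open>l * (a \<bullet> w)\<close> is
    \<open>- (\<bar>w \<bullet> (x0, 1)\<bar> + 1)\<close>, which outweighs the value of
    \<open>w\<close> at \<open>x0\<close>.\<close>
  define l where "l = (\<bar>w \<bullet> (x0, 1)\<bar> + 1) / - (a \<bullet> w)"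
  have "a \<bullet> w < 0" using ab(1) \<open>b < 0\<close> by simp
  then have "0 < l" by (auto simp: l_def intro!: divide_pos_neg add_nonneg_pos)
  \<comment> \<open>The dehomogenisation of \<open>(x0, 1) + l *\<^sub>R (y, t)\<close>.\<close>
  define z where "z = (1 / (1 + l * t)) *\<^sub>R (x0 + l *\<^sub>R y)"
  have pos: "0 < 1 + l * t"
    using \<open>0 < l\<close> \<open>0 \<le> t\<close> by (simp add: add_pos_nonneg)
  have z: "v \<bullet> (z, 1) = (v \<bullet> (x0, 1) + l * (a \<bullet> v)) / (1 + l * t)" for v
  proof -
    obtain c d where v: "v = (c, d)" by fastforce
    have "c \<bullet> z = (c \<bullet> x0 + l * (c \<bullet> y)) / (1 + l * t)"
      by (simp add: z_def inner_add_right)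
    then have "c \<bullet> z + d = (c \<bullet> x0 + l * (c \<bullet> y) + d * (1 + l * t)) / (1 + l * t)"
      using pos by (simp add: add_divide_distrib)
    then show ?thesis
      by (simp add: v a inner_commute[of y] algebra_simps)
  qed
  have "0 \<le> w \<bullet> (z, 1)"
  proof (rule w)
    fix g assume "g \<in> G"
    then show "0 \<le> g \<bullet> (z, 1)"
      unfolding z using pos \<open>0 < l\<close> x0[of g] nonneg[of g] by (simp add: hull_inc)
  qed
  moreover have "w \<bullet> (x0, 1) + l * (a \<bullet> w) < 0"
    using \<open>a \<bullet> w < 0\<close> by (simp add: l_def)
  ultimately show False
    unfolding z using pos by (simp add: zero_le_divide_iff)
qed

lemma affine_nonneg_convex_hull:
  fixes w :: "'a::real_inner \<times> real"
  assumes "\<And>s. s \<in> S \<Longrightarrow> 0 \<le> w \<bullet> (s, 1)" "x \<in> convex hull S"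
  shows "0 \<le> w \<bullet> (x, 1)"
proof -
  have "{x. 0 \<le> w \<bullet> (x, 1)} = {x. fst w \<bullet> x \<ge> - snd w}"
    by (cases w) (auto simp: algebra_simps)
  then have "convex {x. 0 \<le> w \<bullet> (x, 1)}"
    by (simp add: convex_halfspace_ge)
  then show ?thesis
    using hull_minimal[of S "{x. 0 \<le> w \<bullet> (x, 1)}" convex] assms by blast
qed

text \<open>A facet is the hull of some points of \<open>S\<close> and has dimension one less than
  the polytope, so adjoining any point off its hyperplane restores the full affine hull.\<close>

lemma facet_insert_affine_hull:
  fixes S :: "'a::euclidean_space set"
  assumes "finite S" "C facet_of convex hull S"
    and C: "C = convex hull S \<inter> {x. a \<bullet> x = b}"
    and s: "s \<in> S" and q: "q \<in> S" "a \<bullet> q \<noteq> b"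
  shows "s \<in> affine hull (insert q (S \<inter> {x. a \<bullet> x = b}))"
proof -
  have face: "C face_of convex hull S" and dim: "aff_dim C = aff_dim (convex hull S) - 1"
    using assms(2) by (auto simp: facet_of_def)
  obtain S' where S': "S' \<subseteq> S" "C = convex hull S'"
    using face_of_convex_hull_subset[OF finite_imp_compact[OF \<open>finite S\<close>] face] .
  have "S' \<subseteq> C"
    by (simp add: S' hull_subset)
  then have sub: "S' \<subseteq> S \<inter> {x. a \<bullet> x = b}"
    using S' C by blast
  have "affine hull S' \<subseteq> {x. a \<bullet> x = b}"
    using sub by (intro hull_minimal affine_hyperplane) auto
  then have "q \<notin> affine hull S'"
    using q by auto
  then have "aff_dim (insert q S') = aff_dim S"
    using dim S' by (simp add: aff_dim_insert aff_dim_convex_hull)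
  then have "affine hull (insert q S') = affine hull S"
    using S' q by (subst aff_dim_eq_full_gen[symmetric]) auto
  then have "s \<in> affine hull (insert q S')"
    using s by (simp add: hull_inc)
  then show ?thesis
    using hull_mono[of "insert q S'" "insert q (S \<inter> {x. a \<bullet> x = b})"] sub by blast
qed

section \<open>Exact sets are two-level\<close>

text \<open>
  In the proof, the linear functional sending \<open>f\<close> to
  \<open>((1 + d) (c q)\<^sup>2 + d) f q + K (\<Sum>p\<in>T. (c p)\<^sup>2 f p) - f s\<close>
  is nonnegative on 1-sos polynomials.  It is a positive multiple, by \<open>t\<close>, of evaluation at a point \<open>z\<close>,
  so \<open>z\<close> lies in the theta body.  The extra summand \<open>d f q\<close> only serves to make \<open>t\<close> positive.
\<close>

lemma exact_set_le:
  fixes S :: "(real ^ 'n::finite) set" and g :: "(real ^ 'n) \<times> real"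
  assumes "finite S" and ex: "exact_set S"
    and g: "\<And>s. s \<in> S \<Longrightarrow> 0 \<le> g \<bullet> (s, 1)"
    and T: "T \<subseteq> S" "\<And>p. p \<in> T \<Longrightarrow> g \<bullet> (p, 1) = 0"
    and s: "s \<in> S" "0 < g \<bullet> (s, 1)" and q: "q \<in> S" "0 < g \<bullet> (q, 1)"
    and hull: "s \<in> affine hull (insert q T)"
  shows "g \<bullet> (q, 1) \<le> g \<bullet> (s, 1)"
proof -
  have "finite T" "q \<notin> T"
    using T q \<open>finite S\<close> finite_subset by auto
  then obtain c where c1: "sum c (insert q T) = 1" and cs: "(\<Sum>v\<in>insert q T. c v *\<^sub>R v) = s"
    using hull by (auto simp: affine_hull_finite)
  have eval: "h \<bullet> (s, 1) = c q * (h \<bullet> (q, 1)) + (\<Sum>p\<in>T. c p * (h \<bullet> (p, 1)))"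
    for h :: "(real ^ 'n) \<times> real"
  proof -
    obtain a b where h: "h = (a, b)" by fastforce
    have "h \<bullet> (s, 1) = a \<bullet> (\<Sum>v\<in>insert q T. c v *\<^sub>R v) + sum c (insert q T) * b"
      by (simp add: cs c1 h)
    also have "\<dots> = (\<Sum>v\<in>insert q T. c v * (h \<bullet> (v, 1)))"
      by (simp only: inner_sum_right sum_distrib_right h) (simp add: distrib_left sum.distrib)
    finally show ?thesis using \<open>finite T\<close> \<open>q \<notin> T\<close> by simp
  qed
  have approx: "g \<bullet> (s, 1) \<le> ((1 + d) * (c q)\<^sup>2 + d) * (g \<bullet> (q, 1))" if "0 < d" for d
  proof -
    \<comment> \<open>The factor \<open>1 + 1 / d\<close> comes from splitting a mixed product,
      \<open>card T\<close> from the Cauchy-Schwarz inequality. \<open>K\<close> may grow as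
      \<open>d\<close> shrinks, because it only multiplies values on \<open>T\<close>, where
      \<open>g\<close> vanishes.\<close>
    define K where "K = (1 + 1 / d) * card T"
    have "0 \<le> K" using that by (simp add: K_def)
    have square: "(h \<bullet> (s, 1))\<^sup>2 \<le> (1 + d) * (c q)\<^sup>2 * (h \<bullet> (q, 1))\<^sup>2
        + K * (\<Sum>p\<in>T. (c p)\<^sup>2 * (h \<bullet> (p, 1))\<^sup>2)" for h :: "(real ^ 'n) \<times> real"
    proof -
      define A where "A = c q * (h \<bullet> (q, 1))"
      define B where "B = (\<Sum>p\<in>T. c p * (h \<bullet> (p, 1)))"
      \<comment> \<open>The weighted inequality
        \<open>2 * A * B \<le> d * A\<^sup>2 + B\<^sup>2 / d\<close>, which keeps the coefficient of
        \<open>A\<^sup>2\<close> close to 1.\<close>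
      have "0 \<le> (d * A - B)\<^sup>2 / d"
        using that by simp
      also have "\<dots> = d * A\<^sup>2 - 2 * A * B + B\<^sup>2 / d"
        using that by (simp add: power2_eq_square field_simps)
      finally have "(A + B)\<^sup>2 \<le> (1 + d) * A\<^sup>2 + (1 + 1 / d) * B\<^sup>2"
        by (simp add: power2_sum algebra_simps)
      moreover have "B\<^sup>2 \<le> (\<Sum>p\<in>T. (c p * (h \<bullet> (p, 1)))\<^sup>2) * card T"
        unfolding B_def by (rule sum_squared_le_sum_of_squares)
      then have "(1 + 1 / d) * B\<^sup>2 \<le> K * (\<Sum>p\<in>T. (c p)\<^sup>2 * (h \<bullet> (p, 1))\<^sup>2)"
        unfolding K_def mult.assoc using that
        by (intro mult_left_mono) (auto simp: power_mult_distrib mult.commute)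
      ultimately show ?thesis
        by (simp add: eval A_def B_def power_mult_distrib)
    qed
    have sos: "f s \<le> (1 + d) * (c q)\<^sup>2 * f q + K * (\<Sum>p\<in>T. (c p)\<^sup>2 * f p) \<and> 0 \<le> f q"
      if "\<forall>s\<in>S. f s = (\<Sum>w\<leftarrow>ws. (w \<bullet> (s, 1))\<^sup>2)"
      for f and ws :: "((real ^ 'n) \<times> real) list"
    proof -
      have "(\<Sum>w\<leftarrow>ws. (w \<bullet> (s, 1))\<^sup>2) \<le> (1 + d) * (c q)\<^sup>2 * (\<Sum>w\<leftarrow>ws. (w \<bullet> (q, 1))\<^sup>2)
          + K * (\<Sum>p\<in>T. (c p)\<^sup>2 * (\<Sum>w\<leftarrow>ws. (w \<bullet> (p, 1))\<^sup>2)) \<and> 0 \<le> (\<Sum>w\<leftarrow>ws. (w \<bullet> (q, 1))\<^sup>2)"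
      proof (induction ws)
        case (Cons w ws)
        then show ?case
          using square[of w] by (simp add: distrib_left sum.distrib)
      qed simp
      moreover have "(\<Sum>p\<in>T. (c p)\<^sup>2 * f p) = (\<Sum>p\<in>T. (c p)\<^sup>2 * (\<Sum>w\<leftarrow>ws. (w \<bullet> (p, 1))\<^sup>2))"
        using that T(1) by (intro sum.cong) auto
      ultimately show ?thesis
        using that s q by simp
    qed
    define t where "t = (1 + d) * (c q)\<^sup>2 + d + K * (\<Sum>p\<in>T. (c p)\<^sup>2) - 1"
    \<comment> \<open>The constant 1 is the square of the affine function encoded by
      \<open>(0, 1)\<close>; applying \<open>sos\<close> to it gives
      \<open>d \<le> t\<close>.\<close>
    have "0 < t"
      using sos[of "\<lambda>_. 1" "[(0, 1)]"] \<open>0 < d\<close> by (simp add: t_def)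
    \<comment> \<open>The coefficients inside sum to \<open>t\<close>, so \<open>z\<close> is an
      affine combination and the formula below also accounts for constant terms.\<close>
    define z where "z = (1 / t) *\<^sub>R
      (((1 + d) * (c q)\<^sup>2 + d) *\<^sub>R q + K *\<^sub>R (\<Sum>p\<in>T. (c p)\<^sup>2 *\<^sub>R p) - s)"
    have z: "t * (h \<bullet> (z, 1)) = ((1 + d) * (c q)\<^sup>2 + d) * (h \<bullet> (q, 1))
        + K * (\<Sum>p\<in>T. (c p)\<^sup>2 * (h \<bullet> (p, 1))) - h \<bullet> (s, 1)" for h :: "(real ^ 'n) \<times> real"
    proof -
      obtain a b where h: "h = (a, b)" by fastforce
      have "t * (a \<bullet> z) = ((1 + d) * (c q)\<^sup>2 + d) * (a \<bullet> q)
        + K * (\<Sum>p\<in>T. (c p)\<^sup>2 * (a \<bullet> p)) - a \<bullet> s"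
        using \<open>0 < t\<close> by (simp add: z_def inner_diff_right inner_add_right inner_sum_right)
      moreover have "(\<Sum>p\<in>T. (c p)\<^sup>2 * (h \<bullet> (p, 1))) =
          (\<Sum>p\<in>T. (c p)\<^sup>2 * (a \<bullet> p)) + (\<Sum>p\<in>T. (c p)\<^sup>2) * b"
        by (simp add: h distrib_left sum.distrib sum_distrib_right)
      ultimately show ?thesis
        by (simp add: h t_def algebra_simps)
    qed
    have "z \<in> TH1 (vanishing_ideal S)"
      unfolding TH1_def mem_Collect_eq
    proof (intro allI impI, elim conjE)
      fix f :: "'n mpoly_real"
      assume "linear_poly f" and f: "one_sos_mod (vanishing_ideal S) f"
      obtain w :: "(real ^ 'n) \<times> real" where w: "mp_eval f = (\<lambda>x. w \<bullet> (x, 1))"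
        using \<open>linear_poly f\<close> by (rule linear_polyE)
      obtain ws :: "((real ^ 'n) \<times> real) list"
        where ws: "\<forall>s\<in>S. mp_eval f s = (\<Sum>w\<leftarrow>ws. (w \<bullet> (s, 1))\<^sup>2)"
        using f by (auto simp: one_sos_mod_vanishing_ideal_iff)
      have "0 \<le> d * mp_eval f q"
        using sos[OF ws] \<open>0 < d\<close> by simp
      with sos[OF ws] have "0 \<le> t * (w \<bullet> (z, 1))"
        unfolding z by (simp add: w distrib_right)
      then show "0 \<le> mp_eval f z"
        using \<open>0 < t\<close> by (simp add: w zero_le_mult_iff)
    qed
    then have "z \<in> convex hull S"
      using ex \<open>finite S\<close> by (simp add: exact_set_iff)
    then have "0 \<le> g \<bullet> (z, 1)"
      using affine_nonneg_convex_hull[of S g z] g by blast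
    then have "0 \<le> t * (g \<bullet> (z, 1))"
      using \<open>0 < t\<close> by simp
    then show ?thesis
      unfolding z using T(2) by simp
  qed
  have "g \<bullet> (s, 1) \<le> (c q)\<^sup>2 * (g \<bullet> (q, 1))"
  proof (rule field_le_epsilon)
    fix e :: real assume "0 < e"
    \<comment> \<open>With \<open>d = e / M\<close> the excess over
      \<open>(c q)\<^sup>2 * (g \<bullet> (q, 1))\<close> is \<open>d * M = e\<close>.\<close>
    define M where "M = ((c q)\<^sup>2 + 1) * (g \<bullet> (q, 1))"
    have "0 < M" using q by (simp add: M_def add_nonneg_pos)
    then have "g \<bullet> (s, 1) \<le> ((1 + e / M) * (c q)\<^sup>2 + e / M) * (g \<bullet> (q, 1))"
      using \<open>0 < e\<close> by (intro approx) simp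
    also have "\<dots> = (c q)\<^sup>2 * (g \<bullet> (q, 1)) + e / M * M"
      unfolding M_def by (simp only: distrib_left distrib_right mult_1_left mult_1_right mult.assoc)
    finally show "g \<bullet> (s, 1) \<le> (c q)\<^sup>2 * (g \<bullet> (q, 1)) + e"
      using \<open>0 < M\<close> by simp
  qed
  \<comment> \<open>As \<open>g\<close> vanishes on \<open>T\<close>, \<open>c q\<close> is the
    ratio of its values at \<open>s\<close> and \<open>q\<close>. One factor of the square turns the
    value at \<open>q\<close> into the value at \<open>s\<close>, and the other cancels.\<close>
  moreover have gs: "g \<bullet> (s, 1) = c q * (g \<bullet> (q, 1))"
    using eval[of g] T(2) by simp
  ultimately have "c q * (g \<bullet> (q, 1)) \<le> c q * (g \<bullet> (s, 1))"
    by (simp add: power2_eq_square mult.assoc)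
  moreover have "0 < c q"
    using s q gs by (simp add: zero_less_mult_iff)
  ultimately show ?thesis
    by simp
qed

lemma linear_ineq_description_affineI:
  fixes G :: "((real ^ 'n::finite) \<times> real) set"
  assumes "finite G" "C = {x. \<forall>w\<in>G. 0 \<le> w \<bullet> (x, 1)}" "\<And>w. w \<in> G \<Longrightarrow> R (affine_poly w)"
  shows "\<exists>gs. linear_ineq_description gs C \<and> (\<forall>g\<in>set gs. R g)"
proof -
  obtain ws where "set ws = G"
    using \<open>finite G\<close> finite_list by auto
  then show ?thesis
    using assms by (intro exI[of _ "map affine_poly ws"]) (auto simp: linear_ineq_description_def)
qed

text \<open>The polytope need not be full-dimensional, so the description has two kinds of members:
  inequalities from a minimal family \<open>F\<close>, which define facets, and the equations of the
  affine hull, each written as two opposite inequalities that vanish on \<open>S\<close>.\<close>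

lemma exact_set_imp_two_values:
  fixes S :: "(real ^ 'n::finite) set"
  assumes "finite S" "exact_set S"
  shows "\<exists>gs. linear_ineq_description gs (convex hull S) \<and> (\<forall>g\<in>set gs. at_most_two_values S g)"
proof (cases "S = {}")
  case True
  then show ?thesis
    \<comment> \<open>The infeasible inequality \<open>-1 \<ge> 0\<close> describes the empty
      hull.\<close>
    by (intro linear_ineq_description_affineI[of "{(0, -1)}"]) (auto simp: at_most_two_values_def)
next
  case False
  let ?P = "convex hull S"
  have "polyhedron ?P"
    using \<open>finite S\<close> by (intro polytope_imp_polyhedron) (auto simp: polytope_def)
  then obtain F where "finite F" and seq: "?P = affine hull ?P \<inter> \<Inter>F"
    and "\<forall>h\<in>F. \<exists>a b. a \<noteq> 0 \<and> h = {x. a \<bullet> x \<le> b}"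
    and psub: "\<forall>F'. F' \<subset> F \<longrightarrow> ?P \<subset> affine hull ?P \<inter> \<Inter>F'"
    unfolding polyhedron_Int_affine_minimal by blast
  then obtain a b where ab: "\<And>h. h \<in> F \<Longrightarrow> a h \<noteq> 0 \<and> h = {x. a h \<bullet> x \<le> b h}"
    by metis
  obtain E where "finite E" and E: "affine hull ?P = \<Inter>E"
    and "\<And>h. h \<in> E \<Longrightarrow> \<exists>c d. c \<noteq> 0 \<and> h = {x. c \<bullet> x = d}"
    using affine_hull_finite_intersection_hyperplanes[of ?P] by metis
  then obtain c d where cd: "\<And>h. h \<in> E \<Longrightarrow> h = {x. c h \<bullet> x = d h}"
    by metis
  let ?G = "(\<lambda>h. (- a h, b h)) ` F \<union> ((\<lambda>h. (c h, - d h)) ` E \<union> (\<lambda>h. (- c h, d h)) ` E)"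
  have "x \<in> ?P \<longleftrightarrow> (\<forall>h\<in>F. a h \<bullet> x \<le> b h) \<and> (\<forall>h\<in>E. c h \<bullet> x = d h)" for x
  proof -
    have "x \<in> ?P \<longleftrightarrow> (\<forall>h\<in>F. x \<in> h) \<and> (\<forall>h\<in>E. x \<in> h)"
      by (subst seq, subst E) blast
    moreover have "x \<in> h \<longleftrightarrow> a h \<bullet> x \<le> b h" if "h \<in> F" for h
      using arg_cong[OF conjunct2[OF ab[OF that]], of "\<lambda>A. x \<in> A"] by simp
    moreover have "x \<in> h \<longleftrightarrow> c h \<bullet> x = d h" if "h \<in> E" for h
      using arg_cong[OF cd[OF that], of "\<lambda>A. x \<in> A"] by simp
    ultimately show ?thesis by auto
  qed
  then have P: "?P = {x. (\<forall>h\<in>F. a h \<bullet> x \<le> b h) \<and> (\<forall>h\<in>E. c h \<bullet> x = d h)}"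
    by blast
  show ?thesis
  proof (rule linear_ineq_description_affineI)
    show "finite ?G"
      using \<open>finite F\<close> \<open>finite E\<close> by simp
    show "?P = {x. \<forall>w\<in>?G. 0 \<le> w \<bullet> (x, 1)}"
      unfolding P by (auto simp: ball_Un order_antisym)
  next
    fix w assume "w \<in> ?G"
    have "\<exists>y. \<forall>s\<in>S. w \<bullet> (s, 1) \<in> {0, y}"
    proof (cases "w \<in> (\<lambda>h. (- a h, b h)) ` F")
      case True
      then obtain h where h: "h \<in> F" and w: "w = (- a h, b h)" by blast
      have facet: "(?P \<inter> {x. a h \<bullet> x = b h}) facet_of ?P"
        using facet_of_polyhedron_explicit[OF \<open>finite F\<close> seq ab psub[rule_format]] h by blast
      have pos: "0 \<le> w \<bullet> (s, 1)" if "s \<in> S" for s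
        using hull_inc[OF that, of convex] h by (simp add: P w)
      have le: "w \<bullet> (q, 1) \<le> w \<bullet> (s, 1)"
        if "s \<in> S" "q \<in> S" "0 < w \<bullet> (s, 1)" "0 < w \<bullet> (q, 1)" for s q
      proof (rule exact_set_le[OF assms pos])
        show "s \<in> affine hull (insert q (S \<inter> {x. a h \<bullet> x = b h}))"
          using that w by (intro facet_insert_affine_hull[OF \<open>finite S\<close> facet]) auto
      qed (use that w in auto)
      show ?thesis
      proof (cases "\<exists>q\<in>S. 0 < w \<bullet> (q, 1)")
        case True
        then obtain q where q: "q \<in> S" "0 < w \<bullet> (q, 1)" by blast
        \<comment> \<open>Using \<open>le\<close> in both directions makes all positive values
          agree.\<close>
        have "w \<bullet> (s, 1) = w \<bullet> (q, 1)" if "s \<in> S" "w \<bullet> (s, 1) \<noteq> 0" for s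
        proof -
          have "0 < w \<bullet> (s, 1)"
            using pos[OF that(1)] that(2) by linarith
          then show ?thesis
            using le[of s q] le[of q s] q that(1) by linarith
        qed
        then show ?thesis by blast
      next
        case False
        then have "w \<bullet> (s, 1) = 0" if "s \<in> S" for s
          using pos[OF that] that by (meson not_less order_antisym)
        then show ?thesis by blast
      qed
    next
      case False
      then have "w \<bullet> (s, 1) = 0" if "s \<in> S" for s
        using \<open>w \<in> ?G\<close> hull_inc[OF that, of convex] unfolding P by auto
      then show ?thesis by blast
    qed
    then obtain y where "\<forall>s\<in>S. w \<bullet> (s, 1) \<in> {0, y}" by blast
    then have y: "mp_eval (affine_poly w) ` S \<subseteq> {0, y}" by auto
    show "at_most_two_values S (affine_poly w)"
      unfolding at_most_two_values_def
    proof
      show "finite (mp_eval (affine_poly w) ` S)"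
        using \<open>finite S\<close> by simp
      have "card (mp_eval (affine_poly w) ` S) \<le> card {0, y}"
        using y by (intro card_mono) auto
      also have "\<dots> \<le> 2"
        by (simp add: card_insert_if)
      finally show "card (mp_eval (affine_poly w) ` S) \<le> 2" .
    qed
  qed
qed

section \<open>From two-level descriptions to exactness\<close>

text \<open>Replaces the members of a description one at a time: the new inequality must hold on
  \<open>C\<close> and imply the old one, so the set described is unchanged. It serves both
  normalisations below, the shift and the scaling.\<close>

lemma linear_ineq_description_refine:
  fixes C :: "(real ^ 'n::finite) set"
  assumes gs: "linear_ineq_description gs C" "\<And>g. g \<in> set gs \<Longrightarrow> Q g"
    and step: "\<And>g (w :: (real ^ 'n) \<times> real).
      Q g \<Longrightarrow> mp_eval g = (\<lambda>x. w \<bullet> (x, 1)) \<Longrightarrow> (\<And>x. x \<in> C \<Longrightarrow> 0 \<le> w \<bullet> (x, 1)) \<Longrightarrow>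
      \<exists>v. R (affine_poly v) \<and> (\<forall>x\<in>C. 0 \<le> v \<bullet> (x, 1)) \<and> (\<forall>x. 0 \<le> v \<bullet> (x, 1) \<longrightarrow> 0 \<le> w \<bullet> (x, 1))"
  shows "\<exists>gs. linear_ineq_description gs C \<and> (\<forall>g\<in>set gs. R g)"
proof -
  have "\<forall>g. \<exists>v. g \<in> set gs \<longrightarrow> R (affine_poly v) \<and> (\<forall>x\<in>C. 0 \<le> v \<bullet> (x, 1)) \<and>
      (\<forall>x. 0 \<le> v \<bullet> (x, 1) \<longrightarrow> 0 \<le> mp_eval g x)"
  proof
    fix g
    show "\<exists>v. g \<in> set gs \<longrightarrow> R (affine_poly v) \<and> (\<forall>x\<in>C. 0 \<le> v \<bullet> (x, 1)) \<and>
      (\<forall>x. 0 \<le> v \<bullet> (x, 1) \<longrightarrow> 0 \<le> mp_eval g x)"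
    proof (cases "g \<in> set gs")
      case True
      then have "linear_poly g"
        using gs by (simp add: linear_ineq_description_def)
      then obtain w :: "(real ^ 'n) \<times> real" where w: "mp_eval g = (\<lambda>x. w \<bullet> (x, 1))"
        by (rule linear_polyE)
      moreover have "0 \<le> w \<bullet> (x, 1)" if "x \<in> C" for x
        using that True gs w by (auto simp: linear_ineq_description_def)
      ultimately show ?thesis
        using step[OF gs(2)[OF True] w] by auto
    qed simp
  qed
  then obtain v where v: "\<And>g. g \<in> set gs \<Longrightarrow> R (affine_poly (v g))"
    "\<And>g x. g \<in> set gs \<Longrightarrow> x \<in> C \<Longrightarrow> 0 \<le> v g \<bullet> (x, 1)"
    "\<And>g x. g \<in> set gs \<Longrightarrow> 0 \<le> v g \<bullet> (x, 1) \<Longrightarrow> 0 \<le> mp_eval g x"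
    by metis
  have "C = {x. \<forall>w\<in>v ` set gs. 0 \<le> w \<bullet> (x, 1)}"
    using v(2,3) gs(1) by (auto simp: linear_ineq_description_def)
  then show ?thesis
    using v(1) by (intro linear_ineq_description_affineI[of "v ` set gs"]) auto
qed

text \<open>Subtracting the minimum of \<open>g\<close> over \<open>S\<close>, attained at
  \<open>p\<close>, makes one of the values 0. If another value is attained at \<open>q\<close>,
  then \<open>q - p\<close> is the translation vector. The minimum is nonnegative, so the shifted
  inequality implies the old one.\<close>

lemma two_values_imp_two_translates:
  fixes S :: "(real ^ 'n::finite) set"
  assumes "finite S" and desc: "linear_ineq_description gs (convex hull S)"
    and two: "\<And>g. g \<in> set gs \<Longrightarrow> at_most_two_values S g"
  shows "\<exists>gs. linear_ineq_description gs (convex hull S) \<and> (\<forall>g\<in>set gs. in_two_translates S g)"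
proof (cases "S = {}")
  case True
  then show ?thesis
    using desc by (auto simp: in_two_translates_def)
next
  case False
  show ?thesis
  proof (rule linear_ineq_description_refine[OF desc two])
    fix g :: "'n mpoly_real" and w :: "(real ^ 'n) \<times> real"
    assume g: "at_most_two_values S g" "mp_eval g = (\<lambda>x. w \<bullet> (x, 1))"
      and pos: "\<And>x. x \<in> convex hull S \<Longrightarrow> 0 \<le> w \<bullet> (x, 1)"
    obtain p where p: "p \<in> S" "\<And>s. s \<in> S \<Longrightarrow> w \<bullet> (p, 1) \<le> w \<bullet> (s, 1)"
      using arg_min_if_finite[OF \<open>finite S\<close> False, of "\<lambda>x. w \<bullet> (x, 1)"] by (metis not_less)
    define v where "v = w - (0, w \<bullet> (p, 1))"
    have v: "v \<bullet> (x, 1) = w \<bullet> (x, 1) - w \<bullet> (p, 1)" for x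
      by (simp add: v_def inner_diff_left)
    have "\<exists>u. \<forall>s\<in>S. v \<bullet> (s, 1) = 0 \<or> v \<bullet> (s - u, 1) = 0"
    proof (cases "\<exists>q\<in>S. w \<bullet> (q, 1) \<noteq> w \<bullet> (p, 1)")
      case True
      then obtain q where q: "q \<in> S" "w \<bullet> (q, 1) \<noteq> w \<bullet> (p, 1)" by blast
      have "w \<bullet> (s, 1) = w \<bullet> (q, 1)" if "s \<in> S" "w \<bullet> (s, 1) \<noteq> w \<bullet> (p, 1)" for s
      proof (rule ccontr)
        assume "w \<bullet> (s, 1) \<noteq> w \<bullet> (q, 1)"
        then have "card {w \<bullet> (p, 1), w \<bullet> (q, 1), w \<bullet> (s, 1)} = 3"
          using that q by auto
        moreover have "card {w \<bullet> (p, 1), w \<bullet> (q, 1), w \<bullet> (s, 1)} \<le> card (mp_eval g ` S)"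
          using \<open>finite S\<close> that q p g(2) by (intro card_mono) (auto simp: image_iff)
        ultimately show False
          using g(1) by (simp add: at_most_two_values_def)
      qed
      then have "v \<bullet> (s, 1) = 0 \<or> v \<bullet> (s - (q - p), 1) = 0" if "s \<in> S" for s
        using that unfolding v by (cases w) (force simp: inner_diff_right)
      then show ?thesis by blast
    next
      case False
      then show ?thesis by (auto simp: v)
    qed
    then have "in_two_translates S (affine_poly v)"
      by (fastforce simp: in_two_translates_def image_iff algebra_simps)
    moreover have "\<forall>x\<in>convex hull S. 0 \<le> v \<bullet> (x, 1)"
    proof
      fix x assume "x \<in> convex hull S"
      then show "0 \<le> v \<bullet> (x, 1)"
        using p(2) by (intro affine_nonneg_convex_hull[of S v x]) (auto simp: v)
    qed
    moreover have "\<forall>x. 0 \<le> v \<bullet> (x, 1) \<longrightarrow> 0 \<le> w \<bullet> (x, 1)"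
      using pos[of p] p(1) by (simp add: v hull_inc)
    ultimately show "\<exists>v. in_two_translates S (affine_poly v) \<and>
        (\<forall>x\<in>convex hull S. 0 \<le> v \<bullet> (x, 1)) \<and> (\<forall>x. 0 \<le> v \<bullet> (x, 1) \<longrightarrow> 0 \<le> w \<bullet> (x, 1))"
      by blast
  qed
qed

lemma two_translates_imp_idempotent:
  fixes S :: "(real ^ 'n::finite) set"
  assumes desc: "linear_ineq_description gs (convex hull S)"
    and two: "\<And>g. g \<in> set gs \<Longrightarrow> in_two_translates S g"
  shows "\<exists>gs. linear_ineq_description gs (convex hull S) \<and>
    (\<forall>g\<in>set gs. idempotent_mod (vanishing_ideal S) g)"
proof (rule linear_ineq_description_refine[OF desc two])
  fix g :: "'n mpoly_real" and w :: "(real ^ 'n) \<times> real"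
  assume g: "in_two_translates S g" "mp_eval g = (\<lambda>x. w \<bullet> (x, 1))"
    and pos: "\<And>x. x \<in> convex hull S \<Longrightarrow> 0 \<le> w \<bullet> (x, 1)"
  obtain u where u: "S \<subseteq> {x. mp_eval g x = 0} \<union> (\<lambda>x. u + x) ` {x. mp_eval g x = 0}"
    using g(1) by (auto simp: in_two_translates_def)
  \<comment> \<open>A translation vector is a difference of points, hence has last coordinate 0;
    \<open>c\<close> is the change of \<open>w\<close> along it.\<close>
  define c where "c = w \<bullet> (u, 0)"
  have val: "w \<bullet> (s, 1) = 0 \<or> w \<bullet> (s, 1) = c" if "s \<in> S" for s
    using u that g(2) by (cases w) (fastforce simp: c_def inner_add_right)
  \<comment> \<open>A positive \<open>c\<close> is scaled to 1. Otherwise nonnegativity on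
    \<open>S\<close> leaves only the value 0, and any positive factor will do.\<close>
  have "\<exists>k>0. \<forall>s\<in>S. k * (w \<bullet> (s, 1)) = 0 \<or> k * (w \<bullet> (s, 1)) = 1"
  proof (cases "0 < c")
    case True
    then show ?thesis
      using val by (intro exI[of _ "1 / c"]) auto
  next
    case False
    then have "w \<bullet> (s, 1) = 0" if "s \<in> S" for s
      using val[OF that] pos[of s] that by (auto simp: hull_inc)
    then show ?thesis
      by (intro exI[of _ 1]) simp
  qed
  then obtain k where k: "0 < k" "\<And>s. s \<in> S \<Longrightarrow> k * (w \<bullet> (s, 1)) = 0 \<or> k * (w \<bullet> (s, 1)) = 1"
    by blast
  have "idempotent_mod (vanishing_ideal S) (affine_poly (k *\<^sub>R w))"
    using k(2) by (fastforce simp: idempotent_mod_def vanishing_ideal_def mp_eval_diff mp_eval_power)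
  then show "\<exists>v. idempotent_mod (vanishing_ideal S) (affine_poly v) \<and>
      (\<forall>x\<in>convex hull S. 0 \<le> v \<bullet> (x, 1)) \<and> (\<forall>x. 0 \<le> v \<bullet> (x, 1) \<longrightarrow> 0 \<le> w \<bullet> (x, 1))"
    using k(1) pos by (intro exI[of _ "k *\<^sub>R w"]) (auto simp: zero_le_mult_iff)
qed

text \<open>Modulo the ideal, \<open>g\<close> is its own square, and that square is admissible
  because \<open>g\<close> is linear.\<close>

lemma idempotent_imp_one_sos:
  assumes "linear_poly g" "idempotent_mod (vanishing_ideal S) g"
  shows "one_sos_mod (vanishing_ideal S) g"
  unfolding one_sos_mod_def using assms
  by (intro exI[of _ "[g]"]) (auto simp: idempotent_mod_def vanishing_ideal_def mp_eval_diff)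

lemma one_sos_description_imp_one_one_sos:
  fixes S :: "(real ^ 'n::finite) set"
  assumes "finite S" and desc: "linear_ineq_description gs (convex hull S)"
    and sos: "\<And>g. g \<in> set gs \<Longrightarrow> one_sos_mod (vanishing_ideal S) g"
  shows "one_one_sos (vanishing_ideal S)"
proof (cases "S = {}")
  \<comment> \<open>Without a point of \<open>S\<close> there is no feasible \<open>x0\<close> for
    the Farkas argument, but every polynomial then lies in the vanishing ideal.\<close>
  case True
  then show ?thesis
    by (simp add: one_one_sos_def one_sos_mod_vanishing_ideal_iff)
next
  case False
  then obtain x0 where "x0 \<in> S" by blast
  have "\<forall>g. \<exists>w :: (real ^ 'n) \<times> real. g \<in> set gs \<longrightarrow> mp_eval g = (\<lambda>x. w \<bullet> (x, 1))"
    using desc by (metis linear_ineq_description_def linear_polyE)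
  then obtain w :: "_ \<Rightarrow> (real ^ 'n) \<times> real"
    where w: "\<And>g. g \<in> set gs \<Longrightarrow> mp_eval g = (\<lambda>x. w g \<bullet> (x, 1))"
    by metis
  have hull: "x \<in> convex hull S \<longleftrightarrow> (\<forall>v\<in>w ` set gs. 0 \<le> v \<bullet> (x, 1))" for x
    using desc w by (auto simp: linear_ineq_description_def)
  let ?K = "{v. one_sos_mod (vanishing_ideal S) (affine_poly v)}"
  have "one_sos_mod (vanishing_ideal S) f"
    if "linear_poly f" and nonneg: "\<And>s. s \<in> S \<Longrightarrow> 0 \<le> mp_eval f s" for f
  proof -
    obtain v :: "(real ^ 'n) \<times> real" where v: "mp_eval f = (\<lambda>x. v \<bullet> (x, 1))"
      using \<open>linear_poly f\<close> by (rule linear_polyE)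
    have "v \<in> convex_cone hull (insert (0, 1) (w ` set gs))"
    proof (rule affine_Farkas)
      show "0 \<le> u \<bullet> (x0, 1)" if "u \<in> w ` set gs" for u
        using hull_inc[OF \<open>x0 \<in> S\<close>, of convex] that unfolding hull by blast
      show "0 \<le> v \<bullet> (x, 1)" if "\<And>u. u \<in> w ` set gs \<Longrightarrow> 0 \<le> u \<bullet> (x, 1)" for x
        using that hull[of x] nonneg v by (intro affine_nonneg_convex_hull[of S v x]) auto
    qed simp
    also have "\<dots> \<subseteq> ?K"
    proof (rule hull_minimal)
      have "(0, 1) \<in> ?K"
        unfolding one_sos_mod_vanishing_ideal_iff mem_Collect_eq
        by (intro exI[of _ "[(0, 1)]"]) simp
      moreover have "w g \<in> ?K" if "g \<in> set gs" for g
        using sos[OF that] w[OF that] by (simp add: one_sos_mod_vanishing_ideal_iff)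
      ultimately show "insert (0, 1) (w ` set gs) \<subseteq> ?K" by blast
      show "convex_cone ?K" by (rule convex_cone_one_sos)
    qed
    finally show ?thesis
      by (simp add: one_sos_mod_vanishing_ideal_iff v)
  qed
  then show ?thesis
    using \<open>finite S\<close> by (simp add: one_one_sos_def real_variety_vanishing_ideal)
qed

text \<open>A point outside the closed hull is separated from it by a linear polynomial that is
  nonnegative on \<open>S\<close>, hence 1-sos by hypothesis, yet negative at the point. Conversely,
  a linear 1-sos polynomial is nonnegative on \<open>S\<close> and therefore on its hull.\<close>

lemma one_one_sos_imp_exact_set:
  fixes S :: "(real ^ 'n::finite) set"
  assumes "finite S" and sos: "one_one_sos (vanishing_ideal S)"
  shows "exact_set S"
  unfolding exact_set_iff[OF \<open>finite S\<close>]
proof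
  show "TH1 (vanishing_ideal S) \<subseteq> convex hull S"
  proof (rule subsetI, rule ccontr)
    fix x assume x: "x \<in> TH1 (vanishing_ideal S)" "x \<notin> convex hull S"
    have "closed (convex hull S)"
      using \<open>finite S\<close> by (simp add: finite_imp_compact_convex_hull compact_imp_closed)
    then obtain a b where ab: "a \<bullet> x < b" "\<forall>y\<in>convex hull S. a \<bullet> y > b"
      using separating_hyperplane_closed_point[of "convex hull S" x] x(2) by auto
    have "0 \<le> mp_eval (affine_poly (a, - b)) s" if "s \<in> S" for s
      using ab(2) hull_inc[OF that, of convex] by fastforce
    then have "one_sos_mod (vanishing_ideal S) (affine_poly (a, - b))"
      using sos \<open>finite S\<close>
      by (simp add: one_one_sos_def real_variety_vanishing_ideal del: mp_eval_affine_poly)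
    then have "0 \<le> mp_eval (affine_poly (a, - b)) x"
      using x(1) by (simp add: TH1_def del: mp_eval_affine_poly)
    with ab(1) show False by simp
  qed
  show "convex hull S \<subseteq> TH1 (vanishing_ideal S)"
  proof
    fix x assume x: "x \<in> convex hull S"
    have "0 \<le> mp_eval f x" if "linear_poly f" "one_sos_mod (vanishing_ideal S) f" for f
    proof -
      obtain w :: "(real ^ 'n) \<times> real" where w: "mp_eval f = (\<lambda>x. w \<bullet> (x, 1))"
        using \<open>linear_poly f\<close> by (rule linear_polyE)
      have "0 \<le> mp_eval f s" if "s \<in> S" for s
        using \<open>one_sos_mod (vanishing_ideal S) f\<close> that
        by (auto simp: one_sos_mod_vanishing_ideal_iff intro!: sum_list_nonneg)
      then show ?thesis
        using x unfolding w by (rule affine_nonneg_convex_hull)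
    qed
    then show "x \<in> TH1 (vanishing_ideal S)"
      by (simp add: TH1_def)
  qed
qed

theorem theorem4p2:
  fixes S :: "(real ^ 'n::finite) set"
  assumes "finite S"
  defines "I \<equiv> vanishing_ideal S"
  shows "(exact_set S \<longleftrightarrow> one_one_sos I)
    \<and> (exact_set S \<longleftrightarrow>
         (\<exists>gs. linear_ineq_description gs (convex hull S) \<and> (\<forall>g\<in>set gs. one_sos_mod I g)))
    \<and> (exact_set S \<longleftrightarrow>
         (\<exists>gs. linear_ineq_description gs (convex hull S) \<and> (\<forall>g\<in>set gs. idempotent_mod I g)))
    \<and> (exact_set S \<longleftrightarrow>
         (\<exists>gs. linear_ineq_description gs (convex hull S) \<and> (\<forall>g\<in>set gs. at_most_two_values S g)))
    \<and> (exact_set S \<longleftrightarrow>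
         (\<exists>gs. linear_ineq_description gs (convex hull S) \<and> (\<forall>g\<in>set gs. in_two_translates S g)))"
    (is "(?E \<longleftrightarrow> ?O) \<and> (?E \<longleftrightarrow> ?sos) \<and> (?E \<longleftrightarrow> ?idem) \<and> (?E \<longleftrightarrow> ?two) \<and> (?E \<longleftrightarrow> ?trans)")
proof -
  \<comment> \<open>The implications form a single cycle. The translate form stands between two
    values and idempotence, since one value must be moved to 0 before the other is scaled to
    1.\<close>
  have "?E \<Longrightarrow> ?two"
    by (rule exact_set_imp_two_values[OF \<open>finite S\<close>])
  moreover have "?two \<Longrightarrow> ?trans"
    using two_values_imp_two_translates[OF \<open>finite S\<close>] by blast
  moreover have "?trans \<Longrightarrow> ?idem"
    unfolding I_def using two_translates_imp_idempotent by blast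
  moreover have "?idem \<Longrightarrow> ?sos"
    unfolding I_def by (metis idempotent_imp_one_sos linear_ineq_description_def)
  moreover have "?sos \<Longrightarrow> ?O"
    unfolding I_def using one_sos_description_imp_one_one_sos[OF \<open>finite S\<close>] by blast
  moreover have "?O \<Longrightarrow> ?E"
    unfolding I_def by (rule one_one_sos_imp_exact_set[OF \<open>finite S\<close>])
  ultimately show ?thesis by argo
qed

end
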